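(* Let $d\ge 3$ be an integer, let $a>0$ and $b$ be real numbers, and let $$\mathcal{P}_0:=\Big\{x\in\mathbb{R}^d : x_i\le b\ (i=1,\ldots,d),\ \sum_{i=1}^dx_i\ge db-a\Big\},$$ $$\mathcal{P}_1:=\Big\{x\in\mathbb{R}^d : x_i\ge 0\ (i=1,\ldots,d),\ \sum_{i=1}^dx_i\le a\Big\}.$$ Consider the facet-describing inequalities of $\mathcal{D}\subset\mathbb{R}^{d+1}$ (A) $-\sum_{i\in T_0}x_i+(a-(d+1-m)b)z_1\le a-(d+1-m)b$, (B) $\sum_{i\in T_1}x_i+(mb-a)z_1\le mb$, where $2\le m\le d-1$, $T_0,T_1\subseteq\{1,\ldots,d\}$, $|T_0|=d+1-m$, $|T_1|=m$. Then every inequality of type (A) or (B) can be obtained via MIR from facet-describing inequalities of $\mathcal{D}$ that are not of type (A) or (B).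
   Context: Points of $\mathbb{R}^{d+1}$ are written $\begin{pmatrix}x\\ z_1\end{pmatrix}$ with $x\in\mathbb{R}^d$, $z_1\in\mathbb{R}$, and $$\mathcal{D}:=\operatorname{conv}\left(\left\{\begin{pmatrix}x\\ 0\end{pmatrix} : x\in\mathcal{P}_0\right\}\cup\left\{\begin{pmatrix}x\\ 1\end{pmatrix} : x\in\mathcal{P}_1\right\}\right)\subset\mathbb{R}^{d+1}.$$ A facet-describing inequality of a polytope is a valid inequality such that the set of points of the polytope satisfying it with equality is a facet (inequalities are identified up to positive multiples). MIR (mixed-integer rounding) inequality: for an inequality $\alpha^\top x+\gamma z_1\le\beta$ with $\alpha\in\mathbb{R}^d$, $\gamma,\beta\in\mathbb{R}$, put $f_0:=\beta-\lfloor\beta\rfloor$, $f_1:=\gamma-\lfloor\gamma\rfloor$, and $t^+:=\max\{t,0\}$. The associated MIR inequality is (as a formal operation on the inequality) $$\left(\lfloor\gamma\rfloor+\frac{(f_1-f_0)^+}{1-f_0}\right)z_1+\frac{1}{1-f_0}\sum_{i:\alpha_i<0}\alpha_ix_i\le\lfloor\beta\rfloor.$$ Obtained via MIR: an inequality $I$ is obtained via MIR from a collection $\mathcal{C}$ of inequalities if there is a nonnegative linear combination of inequalities in $\mathcal{C}$ whose associated MIR inequality is a positive multiple of $I$, where the MIR operation may be carried out either in the variables $(x,z_1)$, or in the complemented variables $(x',z_1')$ given by the affine involution $x_i=b-x_i'$ ($i=1,\ldots,d$), $z_1=1-z_1'$ (that is, the inequalities of $\mathcal{C}$ are rewritten in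 the variables $(x',z_1')$ with all constants moved to the right-hand side, the MIR inequality of a nonnegative combination of them is formed with respect to $(x',z_1')$, and the result is rewritten in the variables $(x,z_1)$). *)

theory Defs
  imports "HOL-Analysis.Analysis"
begin

definition P0 :: "real \<Rightarrow> real \<Rightarrow> (real^'n) set" where
  "P0 a b = {x. (\<forall>i. x $ i \<le> b) \<and> (\<Sum>i\<in>UNIV. x $ i) \<ge> real CARD('n) * b - a}"

definition P1 :: "real \<Rightarrow> (real^'n) set" where
  "P1 a = {x. (\<forall>i. x $ i \<ge> 0) \<and> (\<Sum>i\<in>UNIV. x $ i) \<le> a}"

definition D :: "real \<Rightarrow> real \<Rightarrow> ((real^'n) \<times> real) set" where
  "D a b = convex hull ((\<lambda>x. (x, 0)) ` P0 a b \<union> (\<lambda>x. (x, 1)) ` P1 a)"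

text \<open>The triple \<open>(\<alpha>, \<gamma>, \<beta>)\<close> stands for the inequality \<open>\<alpha> \<bullet> x + \<gamma> * z \<le> \<beta>\<close> in the
  variables \<open>(x, z)\<close>. Sums and scalar multiples of inequalities are those of the product
  vector space.\<close>

type_synonym 'n ineq = "(real^'n) \<times> real \<times> real"

fun sat :: "'n::finite ineq \<Rightarrow> (real^'n) \<times> real \<Rightarrow> bool" where
  "sat (\<alpha>, \<gamma>, \<beta>) (x, z) \<longleftrightarrow> \<alpha> \<bullet> x + \<gamma> * z \<le> \<beta>"

fun tight :: "'n::finite ineq \<Rightarrow> (real^'n) \<times> real \<Rightarrow> bool" where
  "tight (\<alpha>, \<gamma>, \<beta>) (x, z) \<longleftrightarrow> \<alpha> \<bullet> x + \<gamma> * z = \<beta>"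

definition facet_describing :: "((real^'n) \<times> real) set \<Rightarrow> 'n::finite ineq \<Rightarrow> bool" where
  "facet_describing S I \<longleftrightarrow> (\<forall>p\<in>S. sat I p) \<and> {p\<in>S. tight I p} facet_of S"

definition same_ineq :: "'n::finite ineq \<Rightarrow> 'n ineq \<Rightarrow> bool" where
  "same_ineq I J \<longleftrightarrow> (\<exists>r>0. I = r *\<^sub>R J)"

definition nonneg_combs :: "'n::finite ineq set \<Rightarrow> 'n ineq set" where
  "nonneg_combs C =
     {\<Sum>I\<in>S. u I *\<^sub>R I | S u. finite S \<and> S \<subseteq> C \<and> (\<forall>I\<in>S. (u I :: real) \<ge> 0)}"

fun mir :: "'n::finite ineq \<Rightarrow> 'n ineq" where
  "mir (\<alpha>, \<gamma>, \<beta>) =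
     ((1 / (1 - frac \<beta>)) *\<^sub>R (\<chi> i. if \<alpha> $ i < 0 then \<alpha> $ i else 0),
      of_int \<lfloor>\<gamma>\<rfloor> + max (frac \<gamma> - frac \<beta>) 0 / (1 - frac \<beta>),
      of_int \<lfloor>\<beta>\<rfloor>)"

text \<open>Substituting \<open>x\<^sub>i = b - x'\<^sub>i\<close> and \<open>z = 1 - z'\<close> and moving the constants to the right. The
  substitution is an involution, so the same map rewrites an inequality in \<open>(x', z')\<close> in the
  variables \<open>(x, z)\<close>.\<close>

fun complement :: "real \<Rightarrow> 'n::finite ineq \<Rightarrow> 'n ineq" where
  "complement b (\<alpha>, \<gamma>, \<beta>) = (- \<alpha>, - \<gamma>, \<beta> - b * (\<Sum>i\<in>UNIV. \<alpha> $ i) - \<gamma>)"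

lemma sat_complement: "sat (complement b I) (x', z') \<longleftrightarrow> sat I ((\<chi> i. b - x' $ i), 1 - z')"
  by (cases I) (simp add: inner_vec_def sum_subtractf sum_negf right_diff_distrib
      sum_distrib_left mult.commute, auto simp: algebra_simps)

lemma complement_complement: "complement b (complement b I) = I"
  by (cases I) (simp add: sum_negf)

definition obtained_via_mir :: "real \<Rightarrow> 'n::finite ineq set \<Rightarrow> 'n ineq \<Rightarrow> bool" where
  "obtained_via_mir b C I \<longleftrightarrow>
     (\<exists>J\<in>nonneg_combs C. same_ineq (mir J) I) \<or>
     (\<exists>J\<in>nonneg_combs (complement b ` C). same_ineq (complement b (mir J)) I)"

definition type_A :: "real \<Rightarrow> real \<Rightarrow> 'n::finite ineq set" where
  "type_A a b =
     {((\<chi> i. if i \<in> T\<^sub>0 then - 1 else 0),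
       a - (real CARD('n) + 1 - real m) * b,
       a - (real CARD('n) + 1 - real m) * b) | m T\<^sub>0.
      2 \<le> m \<and> m \<le> CARD('n) - 1 \<and> card T\<^sub>0 = CARD('n) + 1 - m}"

definition type_B :: "real \<Rightarrow> real \<Rightarrow> 'n::finite ineq set" where
  "type_B a b =
     {((\<chi> i. if i \<in> T\<^sub>1 then 1 else 0), real m * b - a, real m * b) | m T\<^sub>1.
      2 \<le> m \<and> m \<le> CARD('n) - 1 \<and> card T\<^sub>1 = m}"

text \<open>Inequalities are identified up to positive multiples, so positive multiples of
  inequalities of type A or B are excluded as well.\<close>

definition other_facets :: "real \<Rightarrow> real \<Rightarrow> 'n::finite ineq set" where
  "other_facets a b =
     {J. facet_describing (D a b) J \<and> (\<forall>I \<in> type_A a b \<union> type_B a b. \<not> same_ineq J I)}"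

end

theory Submission
  imports Defs
begin

text \<open>The polytope \<open>D\<close> is the Cayley polytope of the simplex \<open>P1 = conv {0, a e\<^sub>1, \<dots>, a e\<^sub>d}\<close> and its
  reflection \<open>P0 = b 1 - P1\<close>. Every nonempty index set \<open>T\<close> with \<open>k = |T|\<close> gives a facet
  \<open>- (\<Sum>i\<in>T. x\<^sub>i) + q z \<le> q\<close> with \<open>q = a - k b\<close> (\<open>lower_ineq\<close>). Its vertices are \<open>(b 1 - a e\<^sub>i, 0)\<close>
  for \<open>i \<in> T\<close>, \<open>(0, 1)\<close>, and \<open>(a e\<^sub>i, 1)\<close> for \<open>i \<notin> T\<close>, and every affine function that is constant
  on these vertices has its linear part proportional to the left-hand side of the inequality, so
  the face has codimension one (\<open>facet_describing_lower_ineq\<close>). Type A consists of the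
  inequalities with \<open>2 \<le> k \<le> d - 1\<close>.

  The map \<open>(x, z) \<mapsto> (b 1 - x, 1 - z)\<close> preserves \<open>D\<close> and acts on inequalities as
  \<open>complement b\<close>. It exchanges types A and B and therefore preserves the set of the other facets.
  Hence the upper inequalities \<open>complement b (lower_ineq a b T)\<close> describe facets too, and type B
  reduces to type A through the complemented form of the rounding.

  For type A, the sum of the lower inequality for all indices and the upper inequalities for
  the single indices \<open>i \<notin> T\<close> is
  \<open>- (\<Sum>i\<in>T. x\<^sub>i) + (q - e) z \<le> q\<close> with \<open>e = (d - k) a \<ge> 0\<close>.
  It has the required left-hand side except that the coefficient of \<open>z\<close> is too small by \<open>e\<close>, and
  rounding repairs this. Choose \<open>r > 0\<close> with \<open>r q = N \<in> {-1, 0, 1}\<close> and put \<open>s = r e\<close>.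
  Multiply the sum by \<open>r / (1 + s)\<close> and add \<open>s (1 + N) / (1 + s)\<close> times \<open>z \<le> 1\<close>, which is also
  a facet inequality; this factor is nonnegative since \<open>N \<ge> -1\<close>. The coefficient of \<open>z\<close>
  becomes exactly \<open>N\<close> and the right-hand side becomes \<open>N + s / (1 + s)\<close>. Rounding lowers the
  right-hand side to \<open>N = r q\<close>, keeps the coefficient \<open>N\<close> of \<open>z\<close>, and divides the coefficients of
  \<open>x\<close> by \<open>1 - s / (1 + s) = 1 / (1 + s)\<close>, so that they become \<open>- r\<close> on \<open>T\<close>. The result is \<open>r\<close>
  times the desired inequality (\<open>mir_lower_ineq\<close>, \<open>lower_ineq_via_mir\<close>).\<close>

section \<open>A criterion for facets\<close>

text \<open>A dual form of the dimension count: if the dimension were smaller, then some nonzero vector would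
  be orthogonal both to all differences of points of \<open>F\<close> and to \<open>c\<close>. By assumption such a vector
  is a multiple of \<open>c\<close>, hence zero. This avoids exhibiting affinely independent points.\<close>

lemma aff_dim_hyperplane_subset:
  fixes F :: "'a::euclidean_space set"
  assumes "c \<noteq> 0" "F \<subseteq> {p. c \<bullet> p = \<beta>}" "p0 \<in> F"
    and normal: "\<And>w. (\<And>p. p \<in> F \<Longrightarrow> w \<bullet> p = w \<bullet> p0) \<Longrightarrow> \<exists>t. w = t *\<^sub>R c"
  shows "aff_dim F = int DIM('a) - 1"
proof (rule antisym)
  have "aff_dim F \<le> aff_dim {p. c \<bullet> p = \<beta>}"
    using assms(2) by (rule aff_dim_subset)
  then show "aff_dim F \<le> int DIM('a) - 1"
    using \<open>c \<noteq> 0\<close> by (simp add: aff_dim_hyperplane)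
  show "int DIM('a) - 1 \<le> aff_dim F"
  proof (rule ccontr)
    assume small: "\<not> int DIM('a) - 1 \<le> aff_dim F"
    let ?V = "(\<lambda>p. p - p0) ` F"
    have "aff_dim F = int (dim ?V)"
      using hull_inc[OF assms(3)] by (rule aff_dim_eq_dim_subtract)
    then have "dim ?V + 1 < DIM('a)"
      using small by linarith
    then have "dim (insert c ?V) < DIM('a)"
      unfolding dim_insert by (cases "c \<in> span ?V") simp_all
    then obtain w where w: "w \<noteq> 0" "span (insert c ?V) \<subseteq> {x. w \<bullet> x = 0}"
      using lowdim_subset_hyperplane[of "insert c ?V"] by metis
    have orth: "w \<bullet> x = 0" if "x \<in> insert c ?V" for x
      using subsetD[OF w(2) span_base[OF that]] by simp
    have "w \<bullet> p = w \<bullet> p0" if "p \<in> F" for p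
      using orth[of "p - p0"] that by (simp add: inner_diff_right)
    then have "\<exists>t. w = t *\<^sub>R c"
      by (rule normal)
    then obtain t where t: "w = t *\<^sub>R c" ..
    then have "w \<bullet> w = t * (w \<bullet> c)"
      by (metis inner_scaleR_right)
    with orth[of c] w(1) show False
      by simp
  qed
qed

text \<open>The point \<open>q\<close> off the hyperplane makes the face proper, which forces \<open>S\<close> to be full-dimensional:
  the face has codimension one in the whole space and a smaller dimension than \<open>S\<close>.\<close>

lemma facet_describingI:
  fixes S :: "((real^'n) \<times> real) set"
  assumes "convex S" "(\<alpha>, \<gamma>) \<noteq> 0"
    and valid: "\<And>p. p \<in> S \<Longrightarrow> sat (\<alpha>, \<gamma>, \<beta>) p"
    and strict: "q \<in> S" "\<not> tight (\<alpha>, \<gamma>, \<beta>) q"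
    and p0: "p0 \<in> S" "tight (\<alpha>, \<gamma>, \<beta>) p0"
    and normal: "\<And>u v. (\<And>x z. (x, z) \<in> S \<Longrightarrow> tight (\<alpha>, \<gamma>, \<beta>) (x, z) \<Longrightarrow>
                     u \<bullet> x + v * z = (u, v) \<bullet> p0) \<Longrightarrow> \<exists>t. u = t *\<^sub>R \<alpha> \<and> v = t * \<gamma>"
  shows "facet_describing S (\<alpha>, \<gamma>, \<beta>)"
proof -
  let ?c = "(\<alpha>, \<gamma>)" and ?F = "{p \<in> S. tight (\<alpha>, \<gamma>, \<beta>) p}"
  have sat: "sat (\<alpha>, \<gamma>, \<beta>) p \<longleftrightarrow> ?c \<bullet> p \<le> \<beta>" and tight: "tight (\<alpha>, \<gamma>, \<beta>) p \<longleftrightarrow> ?c \<bullet> p = \<beta>" for p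
    by (cases p; simp)+
  have "?F = S \<inter> {p. ?c \<bullet> p = \<beta>}"
    using tight by auto
  then have face: "?F face_of S"
    using face_of_Int_supporting_hyperplane_le[OF \<open>convex S\<close>, of ?c \<beta>] valid sat by simp
  have dim_F: "aff_dim ?F = int DIM((real^'n) \<times> real) - 1"
  proof (rule aff_dim_hyperplane_subset)
    show "?F \<subseteq> {p. ?c \<bullet> p = \<beta>}"
      using tight by auto
    fix w :: "(real^'n) \<times> real"
    assume w: "\<And>p. p \<in> ?F \<Longrightarrow> w \<bullet> p = w \<bullet> p0"
    obtain u v where uv: "w = (u, v)" by (cases w)
    have "\<exists>t. u = t *\<^sub>R \<alpha> \<and> v = t * \<gamma>"
      using w by (intro normal) (auto simp: uv)
    then show "\<exists>t. w = t *\<^sub>R ?c"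
      by (auto simp: uv)
  qed (use assms(2) p0 in auto)
  have "?F \<noteq> S"
    using strict by auto
  then have "aff_dim ?F < aff_dim S"
    by (rule face_of_aff_dim_lt[OF \<open>convex S\<close> face])
  with dim_F have "aff_dim ?F = aff_dim S - 1"
    using aff_dim_le_DIM[of S] by linarith
  then have "?F facet_of S"
    using face p0 unfolding facet_of_def by blast
  then show ?thesis
    using valid unfolding facet_describing_def by blast
qed

section \<open>The facets of the polytope\<close>

definition lower_ineq :: "real \<Rightarrow> real \<Rightarrow> 'n set \<Rightarrow> 'n::finite ineq" where
  "lower_ineq a b T =
     ((\<chi> i. if i \<in> T then - 1 else 0), a - real (card T) * b, a - real (card T) * b)"

lemma inner_indicator:
  fixes x :: "real^'n"
  shows "(\<chi> i. if i \<in> T then c else 0) \<bullet> x = c * (\<Sum>i\<in>T. x $ i)"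
  by (simp add: inner_vec_def if_distrib[of "\<lambda>y. y * _"] sum.If_cases sum_distrib_left
      cong: if_cong)

lemma inner_const: "u \<bullet> (\<chi> i. c) = c * (\<Sum>i\<in>UNIV. u $ i)"
  by (simp add: inner_vec_def sum_distrib_left mult.commute)

lemma sum_axis: "(\<Sum>i\<in>S. axis j c $ i) = (if j \<in> S then c else (0::real))"
  for j :: "'n::finite"
  by (simp add: axis_def)

lemma const_minus_axis_in_D:
  assumes "a > 0"
  shows "((\<chi> i. b) - axis j a, 0) \<in> (D a b :: ((real^'n) \<times> real) set)"
proof -
  have "(\<chi> i. b) - axis j a \<in> P0 a b"
    using assms by (auto simp: P0_def sum_subtractf sum_axis) (auto simp: axis_def)
  then show ?thesis
    unfolding D_def by (auto intro: hull_inc)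
qed

lemma const_in_D:
  assumes "a > 0"
  shows "((\<chi> i. b), 0) \<in> (D a b :: ((real^'n) \<times> real) set)"
proof -
  have "(\<chi> i. b) \<in> (P0 a b :: (real^'n) set)"
    using assms by (simp add: P0_def)
  then show ?thesis
    unfolding D_def by (auto intro: hull_inc)
qed

lemma zero_in_D:
  assumes "a > 0"
  shows "(0, 1) \<in> D a b"
proof -
  have "0 \<in> P1 a"
    using assms by (simp add: P1_def)
  then show ?thesis
    unfolding D_def by (auto intro: hull_inc)
qed

lemma axis_in_D:
  assumes "a > 0"
  shows "(axis j a, 1) \<in> D a b"
proof -
  have "axis j a \<in> P1 a"
    using assms by (auto simp: P1_def sum_axis) (auto simp: axis_def)
  then show ?thesis
    unfolding D_def by (auto intro: hull_inc)
qed

lemma convex_D: "convex (D a b)"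
  by (simp add: D_def convex_convex_hull)

lemma sat_on_D:
  assumes "\<And>x. x \<in> P0 a b \<Longrightarrow> sat I (x, 0)" "\<And>x. x \<in> P1 a \<Longrightarrow> sat I (x, 1)" "p \<in> D a b"
  shows "sat I p"
proof -
  obtain \<alpha> \<gamma> \<beta> where I: "I = (\<alpha>, \<gamma>, \<beta>)" by (cases I)
  have sat: "{p. sat I p} = {p. (\<alpha>, \<gamma>) \<bullet> p \<le> \<beta>}"
    by (auto simp: I)
  have "D a b \<subseteq> {p. sat I p}"
    unfolding D_def
  proof (rule hull_minimal)
    show "convex {p. sat I p}"
      unfolding sat by (rule convex_halfspace_le)
  qed (use assms in auto)
  with assms(3) show ?thesis by auto
qed

lemma facet_describing_z_le_1:
  assumes "a > 0"
  shows "facet_describing (D a b :: ((real^'n) \<times> real) set) (0, 1, 1)"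
proof (rule facet_describingI)
  show "((\<chi> i. b), 0) \<in> (D a b :: ((real^'n) \<times> real) set)"
    using assms by (rule const_in_D)
  show "(0, 1) \<in> D a b"
    using assms by (rule zero_in_D)
  show "sat (0, 1, 1) p" if "p \<in> (D a b :: ((real^'n) \<times> real) set)" for p
    using _ _ that by (rule sat_on_D) auto
  fix u :: "real^'n" and v :: real
  assume eq: "\<And>x z. (x, z) \<in> D a b \<Longrightarrow> tight (0, 1, 1) (x, z) \<Longrightarrow> u \<bullet> x + v * z = (u, v) \<bullet> (0, 1)"
  have "u $ i = 0" for i
    using eq[OF axis_in_D, of i] assms by (simp add: inner_axis)
  then show "\<exists>t. u = t *\<^sub>R 0 \<and> v = t * 1"
    by (auto simp: vec_eq_iff)
qed (auto simp: convex_D zero_prod_def)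

text \<open>On \<open>P0\<close> the inequality follows from the lower bound on the total sum and the bounds \<open>x\<^sub>i \<le> b\<close> for
  \<open>i \<notin> T\<close>. For the dimension, let \<open>(u, v)\<close> be constant on the vertices listed at the top:
  the points \<open>(0, 1)\<close> and \<open>(a e\<^sub>i, 1)\<close> give \<open>u\<^sub>i = 0\<close> for \<open>i \<notin> T\<close>, and the points
  \<open>(b 1 - a e\<^sub>i, 0)\<close> then show that \<open>u\<close> is constant on \<open>T\<close> and determine \<open>v\<close>.\<close>

lemma facet_describing_lower_ineq:
  fixes T :: "'n::finite set"
  assumes "a > 0" "T \<noteq> {}"
  shows "facet_describing (D a b) (lower_ineq a b T)"
  unfolding lower_ineq_def
proof (rule facet_describingI)
  let ?\<alpha> = "(\<chi> i. if i \<in> T then - 1 else 0) :: real^'n" and ?q = "a - real (card T) * b"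
  from assms(2) obtain j where j: "j \<in> T" by auto
  show "((\<chi> i. b), 0) \<in> (D a b :: ((real^'n) \<times> real) set)"
    using assms(1) by (rule const_in_D)
  show "\<not> tight (?\<alpha>, ?q, ?q) ((\<chi> i. b), 0)"
    using assms by (simp add: inner_indicator)
  show "(0, 1) \<in> D a b"
    using assms(1) by (rule zero_in_D)
  show "(?\<alpha>, ?q) \<noteq> 0"
    using j by (auto simp: zero_prod_def vec_eq_iff intro!: exI[of _ j])
  show "sat (?\<alpha>, ?q, ?q) p" if "p \<in> D a b" for p
    using _ _ that
  proof (rule sat_on_D)
    fix x :: "real^'n"
    assume "x \<in> P0 a b"
    then have le: "\<And>i. x $ i \<le> b" and ge: "real CARD('n) * b - a \<le> (\<Sum>i\<in>UNIV. x $ i)"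
      by (auto simp: P0_def)
    have "(\<Sum>i\<in>-T. x $ i) \<le> real (card (-T)) * b"
      using le by (intro sum_bounded_above)
    moreover have "(\<Sum>i\<in>UNIV. x $ i) = (\<Sum>i\<in>T. x $ i) + (\<Sum>i\<in>-T. x $ i)"
      using sum.union_disjoint[of T "-T" "\<lambda>i. x $ i"] by simp
    moreover have "real CARD('n) = real (card T) + real (card (-T))"
      using card_Un_disjoint[of T "-T"] by simp
    ultimately show "sat (?\<alpha>, ?q, ?q) (x, 0)"
      using ge by (simp add: inner_indicator algebra_simps)
  next
    fix x :: "real^'n"
    assume "x \<in> P1 a"
    then show "sat (?\<alpha>, ?q, ?q) (x, 1)"
      by (auto simp: P1_def inner_indicator intro: sum_nonneg)
  qed
  fix u :: "real^'n" and v :: real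
  assume eq: "\<And>x z. (x, z) \<in> D a b \<Longrightarrow> tight (?\<alpha>, ?q, ?q) (x, z) \<Longrightarrow> u \<bullet> x + v * z = (u, v) \<bullet> (0, 1)"
  have out: "u $ i = 0" if "i \<notin> T" for i
    using eq[OF axis_in_D, of i] assms that by (simp add: inner_axis inner_indicator sum_axis)
  have v: "b * (\<Sum>i\<in>UNIV. u $ i) - a * u $ i = v" if "i \<in> T" for i
    using eq[OF const_minus_axis_in_D, of i] assms that
    by (simp add: inner_axis inner_indicator sum_subtractf sum_axis inner_diff_right inner_const
        sum.If_cases mult.commute)
  have const: "u $ i = u $ j" if "i \<in> T" for i
  proof -
    have "a * u $ i = a * u $ j"
      using v[OF that] v[OF j] by linarith
    then show ?thesis
      using assms(1) by simp
  qed
  have "(\<Sum>i\<in>UNIV. u $ i) = (\<Sum>i\<in>T. u $ j)"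
    by (rule sum.mono_neutral_cong_right) (use out const in auto)
  then have "v = - u $ j * ?q"
    using v[OF j] by (simp add: algebra_simps)
  moreover have "u = (- u $ j) *\<^sub>R ?\<alpha>"
    using out const by (simp add: vec_eq_iff)
  ultimately show "\<exists>t. u = t *\<^sub>R ?\<alpha> \<and> v = t * ?q"
    by blast
qed (auto simp: convex_D)

section \<open>The symmetry of the polytope\<close>

text \<open>Written as a negation followed by a translation, so that faces, affine dimensions and convex
  hulls are transported by the invariance under linear injections and under translations.\<close>

definition point_reflection :: "real \<Rightarrow> (real^'n) \<times> real \<Rightarrow> (real^'n) \<times> real" where
  "point_reflection b p = ((\<chi> i. b), 1) + - p"

lemma point_reflection_involution: "point_reflection b (point_reflection b p) = p"
  by (simp add: point_reflection_def)

lemma point_reflection_image: "point_reflection b ` S = (+) ((\<chi> i. b), 1) ` uminus ` S"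
  by (auto simp: point_reflection_def image_image)

lemma complement_point_reflection:
  "sat (complement b I) p \<longleftrightarrow> sat I (point_reflection b p)"
  "tight (complement b I) p \<longleftrightarrow> tight I (point_reflection b p)"
proof -
  obtain \<alpha> \<gamma> \<beta> x z where I: "I = (\<alpha>, \<gamma>, \<beta>)" "p = (x, z)"
    by (metis prod.exhaust)
  show "sat (complement b I) p \<longleftrightarrow> sat I (point_reflection b p)"
    by (simp add: I point_reflection_def inner_diff_right inner_const algebra_simps)
  show "tight (complement b I) p \<longleftrightarrow> tight I (point_reflection b p)"
    by (simp add: I point_reflection_def inner_diff_right inner_const right_diff_distrib) linarith
qed

lemma point_reflection_P0: "(\<chi> i. b) - x \<in> P1 a \<longleftrightarrow> x \<in> P0 a b" for x :: "real^'n"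
  by (auto simp: P0_def P1_def sum_subtractf algebra_simps)

lemma point_reflection_P1: "(\<chi> i. b) - x \<in> P0 a b \<longleftrightarrow> x \<in> P1 a" for x :: "real^'n"
  using point_reflection_P0[of b "(\<chi> i. b) - x" a] by simp

lemma point_reflection_D: "point_reflection b ` D a b = (D a b :: ((real^'n) \<times> real) set)"
proof -
  let ?V = "(\<lambda>x. (x, 0)) ` P0 a b \<union> (\<lambda>x. (x, 1)) ` P1 a :: ((real^'n) \<times> real) set"
  have sub: "point_reflection b ` ?V \<subseteq> ?V"
    by (auto simp: point_reflection_def point_reflection_P0 point_reflection_P1)
  have "?V = point_reflection b ` point_reflection b ` ?V"
    by (simp only: image_image point_reflection_involution image_ident)
  also have "\<dots> \<subseteq> point_reflection b ` ?V"
    using sub by (rule image_mono)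
  finally have V: "point_reflection b ` ?V = ?V"
    using sub by blast
  have "point_reflection b ` D a b = convex hull (point_reflection b ` ?V)"
    unfolding D_def point_reflection_image
    by (simp only: convex_hull_translation
        convex_hull_linear_image[OF linear_uminus])
  then show ?thesis
    unfolding V D_def .
qed

lemma facet_of_point_reflection:
  fixes S F :: "((real^'n) \<times> real) set"
  assumes "F facet_of S"
  shows "point_reflection b ` F facet_of point_reflection b ` S"
proof -
  have inj: "inj (uminus :: (real^'n) \<times> real \<Rightarrow> _)"
    by (simp add: inj_on_def)
  have "uminus ` F face_of uminus ` S \<longleftrightarrow> F face_of S"
    by (rule face_of_linear_image[OF linear_uminus inj])
  moreover have "aff_dim (uminus ` X) = aff_dim X" for X :: "((real^'n) \<times> real) set"
    by (rule aff_dim_injective_linear_image[OF linear_uminus inj])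
  ultimately show ?thesis
    using assms unfolding facet_of_def point_reflection_image
      face_of_translation_eq aff_dim_translation_eq by simp
qed

lemma facet_describing_complement:
  fixes I :: "'n::finite ineq"
  assumes "facet_describing (D a b) I"
  shows "facet_describing (D a b) (complement b I)"
proof -
  have mem: "point_reflection b p \<in> D a b" if "p \<in> D a b" for p :: "(real^'n) \<times> real"
    using imageI[OF that, of "point_reflection b"] unfolding point_reflection_D .
  have "{p \<in> D a b. tight (complement b I) p} = point_reflection b ` {p \<in> D a b. tight I p}"
    (is "?L = _ ` ?R")
  proof (rule set_eqI, rule iffI)
    fix p
    assume "p \<in> ?L"
    then have "point_reflection b p \<in> ?R"
      using mem by (simp add: complement_point_reflection)
    from imageI[OF this, of "point_reflection b"] show "p \<in> point_reflection b ` ?R"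
      unfolding point_reflection_involution .
  next
    fix p
    assume "p \<in> point_reflection b ` ?R"
    then obtain p' where "p' \<in> ?R" "p = point_reflection b p'" ..
    then show "p \<in> ?L"
      using mem by (simp add: complement_point_reflection point_reflection_involution)
  qed
  moreover have "point_reflection b ` {p \<in> D a b. tight I p} facet_of D a b"
    using facet_of_point_reflection[of "{p \<in> D a b. tight I p}" "D a b" b] assms
    unfolding facet_describing_def point_reflection_D by simp
  moreover have "sat (complement b I) p" if "p \<in> D a b" for p
    using assms mem[OF that] by (simp add: facet_describing_def complement_point_reflection)
  ultimately show ?thesis
    unfolding facet_describing_def by simp
qed

lemma complement_scaleR: "complement b (r *\<^sub>R I) = r *\<^sub>R complement b I"
  by (cases I) (simp add: sum_distrib_left[symmetric] algebra_simps)

lemma same_ineq_complement: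
  assumes "same_ineq I J"
  shows "same_ineq (complement b I) (complement b J)"
  using assms by (auto simp: same_ineq_def complement_scaleR)

lemma complement_lower_ineq:
  "complement b (lower_ineq a b T) =
     ((\<chi> i. if i \<in> T then 1 else 0), real (card T) * b - a, real (card T) * b)"
  by (auto simp: lower_ineq_def vec_eq_iff sum.If_cases algebra_simps)

text \<open>The description of type A by \<open>m = d + 1 - k\<close> is replaced by one by the set alone; the range
  \<open>2 \<le> m \<le> d - 1\<close> is symmetric under \<open>m \<mapsto> d + 1 - m\<close>.\<close>

lemma type_A_eq:
  "type_A a b = {lower_ineq a b T | T :: 'n::finite set. 2 \<le> card T \<and> card T \<le> CARD('n) - 1}"
  (is "_ = ?R")
proof
  show "type_A a b \<subseteq> ?R"
  proof
    fix I :: "'n ineq"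
    assume "I \<in> type_A a b"
    then obtain m and T :: "'n set" where mT: "2 \<le> m" "m \<le> CARD('n) - 1" "card T = CARD('n) + 1 - m"
      and I: "I = ((\<chi> i. if i \<in> T then - 1 else 0), a - (real CARD('n) + 1 - real m) * b,
       a - (real CARD('n) + 1 - real m) * b)"
      unfolding type_A_def by blast
    have "real (card T) = real CARD('n) + 1 - real m" "2 \<le> card T" "card T \<le> CARD('n) - 1"
      using mT by auto
    then show "I \<in> ?R"
      unfolding I lower_ineq_def by (intro CollectI exI[of _ T]) simp
  qed
  show "?R \<subseteq> type_A a b"
  proof
    fix I :: "'n ineq"
    assume "I \<in> ?R"
    then obtain T :: "'n set" where T: "2 \<le> card T" "card T \<le> CARD('n) - 1"
      and I: "I = lower_ineq a b T" by blast
    let ?m = "CARD('n) + 1 - card T"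
    have "2 \<le> ?m" "?m \<le> CARD('n) - 1" "card T = CARD('n) + 1 - ?m"
      "real (card T) = real CARD('n) + 1 - real ?m"
      using T by auto
    then show "I \<in> type_A a b"
      unfolding I lower_ineq_def type_A_def by (intro CollectI exI[of _ ?m] exI[of _ T]) simp
  qed
qed

lemma type_B_eq: "type_B a b = complement b ` (type_A a b :: 'n::finite ineq set)"
proof -
  have "complement b ` type_A a b =
      {complement b (lower_ineq a b T) | T :: 'n set. 2 \<le> card T \<and> card T \<le> CARD('n) - 1}"
    unfolding type_A_eq by blast
  then show ?thesis
    unfolding type_B_def complement_lower_ineq by auto
qed

lemma complement_other_facets:
  "complement b ` other_facets a b = (other_facets a b :: 'n::finite ineq set)"
proof -
  have AB: "complement b I \<in> type_A a b \<union> type_B a b"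
    if "I \<in> type_A a b \<union> type_B a b" for I :: "'n ineq"
    using that
  proof
    assume "I \<in> type_A a b"
    then show ?thesis
      unfolding type_B_eq by (intro UnI2 imageI)
  next
    assume "I \<in> type_B a b"
    then obtain I' where "I' \<in> type_A a b" "I = complement b I'"
      unfolding type_B_eq by (elim imageE)
    then show ?thesis
      by (simp only: complement_complement UnI1)
  qed
  have sub: "complement b J \<in> other_facets a b" if "J \<in> other_facets a b" for J :: "'n ineq"
    unfolding other_facets_def
  proof (intro CollectI conjI ballI notI)
    show "facet_describing (D a b) (complement b J)"
      using that by (auto simp: other_facets_def intro: facet_describing_complement)
    fix I
    assume "I \<in> type_A a b \<union> type_B a b" "same_ineq (complement b J) I"
    then have "same_ineq J (complement b I)" "complement b I \<in> type_A a b \<union> type_B a b"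
      using same_ineq_complement[of "complement b J" I b] AB by (auto simp: complement_complement)
    with that show False
      by (auto simp: other_facets_def)
  qed
  then show ?thesis
    by (auto simp: image_iff) (metis complement_complement sub)
qed

section \<open>Facets outside the two families\<close>

text \<open>The number of variables \<open>x\<^sub>i\<close> that occur is invariant under scaling and lies between \<open>2\<close> and
  \<open>d - 1\<close> for types A and B. It is therefore enough to separate these types from the facets
  that the construction uses, where it is \<open>0\<close>, \<open>1\<close> or \<open>d\<close>.\<close>

definition support :: "'n::finite ineq \<Rightarrow> 'n set" where
  "support I = {i. fst I $ i \<noteq> 0}"

lemma support_same_ineq: "same_ineq I J \<Longrightarrow> support I = support J"
  by (auto simp: same_ineq_def support_def)

lemma support_lower_ineq: "support (lower_ineq a b T) = T"
  by (simp add: support_def lower_ineq_def)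

lemma support_complement: "support (complement b I) = support I"
  by (cases I) (simp add: support_def)

lemma other_facetsI:
  fixes J :: "'n::finite ineq"
  assumes "facet_describing (D a b) J" "card (support J) < 2 \<or> card (support J) = CARD('n)"
  shows "J \<in> other_facets a b"
proof -
  have "2 \<le> card (support I) \<and> card (support I) \<le> CARD('n) - 1"
    if I: "I \<in> type_A a b \<union> type_B a b" for I :: "'n ineq"
  proof -
    obtain I' :: "'n ineq" where I': "I' \<in> type_A a b" "I = I' \<or> I = complement b I'"
      using I unfolding type_B_eq by (elim UnE imageE) simp_all
    then obtain T :: "'n set" where T: "I' = lower_ineq a b T" "2 \<le> card T" "card T \<le> CARD('n) - 1"
      unfolding type_A_eq by auto
    have "support I = T"
      using I'(2) T(1) support_lower_ineq[of a b T] support_complement[of b I'] by metis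
    with T show ?thesis
      by simp
  qed
  moreover have "CARD('n) > 0"
    by simp
  ultimately have "\<not> same_ineq J I" if "I \<in> type_A a b \<union> type_B a b" for I
    using that support_same_ineq[of J I] assms(2) by fastforce
  with assms(1) show ?thesis
    by (auto simp: other_facets_def)
qed

section \<open>Mixed-integer rounding\<close>

lemma nonneg_combs_base:
  assumes "I \<in> C"
  shows "I \<in> nonneg_combs C"
  using assms unfolding nonneg_combs_def
  by (intro CollectI exI[of _ "{I}"] exI[of _ "\<lambda>_. 1"]) auto

lemma nonneg_combs_scaleR:
  assumes "I \<in> nonneg_combs C" "r \<ge> 0"
  shows "r *\<^sub>R I \<in> nonneg_combs C"
proof -
  from assms(1) obtain S u where S: "I = (\<Sum>I\<in>S. u I *\<^sub>R I)" "finite S" "S \<subseteq> C" "\<forall>I\<in>S. u I \<ge> (0::real)"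
    unfolding nonneg_combs_def by blast
  then show ?thesis
    using assms(2) unfolding nonneg_combs_def
    by (intro CollectI exI[of _ S] exI[of _ "\<lambda>I. r * u I"]) (simp add: scaleR_sum_right)
qed

lemma nonneg_combs_add:
  assumes "I \<in> nonneg_combs C" "J \<in> nonneg_combs C"
  shows "I + J \<in> nonneg_combs C"
proof -
  from assms(1) obtain S u where S: "I = (\<Sum>I\<in>S. u I *\<^sub>R I)" "finite S" "S \<subseteq> C" "\<forall>I\<in>S. u I \<ge> (0::real)"
    unfolding nonneg_combs_def by blast
  from assms(2) obtain S' u' where S': "J = (\<Sum>I\<in>S'. u' I *\<^sub>R I)" "finite S'" "S' \<subseteq> C" "\<forall>I\<in>S'. u' I \<ge> (0::real)"
    unfolding nonneg_combs_def by blast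
  let ?w = "\<lambda>I. (if I \<in> S then u I else 0) + (if I \<in> S' then u' I else 0)"
  have 1: "I = (\<Sum>I\<in>S \<union> S'. (if I \<in> S then u I else 0) *\<^sub>R I)"
    unfolding S(1) by (rule sum.mono_neutral_cong_left) (use S S' in auto)
  have 2: "J = (\<Sum>I\<in>S \<union> S'. (if I \<in> S' then u' I else 0) *\<^sub>R I)"
    unfolding S'(1) by (rule sum.mono_neutral_cong_left) (use S S' in auto)
  have "I + J = (\<Sum>I\<in>S \<union> S'. ?w I *\<^sub>R I)"
    unfolding 1 2 by (simp only: scaleR_left_distrib sum.distrib)
  then show ?thesis
    using S S' unfolding nonneg_combs_def
    by (intro CollectI exI[of _ "S \<union> S'"] exI[of _ ?w]) auto
qed

lemma nonneg_combs_sum: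
  assumes "\<And>i. i \<in> A \<Longrightarrow> f i \<in> nonneg_combs C"
  shows "sum f A \<in> nonneg_combs C"
proof -
  have "0 \<in> nonneg_combs C"
    unfolding nonneg_combs_def by (intro CollectI exI[of _ "{}"]) auto
  then show ?thesis
    using assms by (induction A rule: infinite_finite_induct) (auto intro: nonneg_combs_add)
qed

text \<open>The upper inequality for \<open>i\<close> is \<open>x\<^sub>i + (b - a) z \<le> b\<close>. Adding it cancels \<open>- x\<^sub>i\<close> and
  moves both the coefficient of \<open>z\<close> and the right-hand side towards those for \<open>T\<close>, except for an
  error of \<open>- a\<close> per index in the former.\<close>

lemma lower_ineq_UNIV_plus_upper_bounds:
  fixes T :: "'n::finite set" and a b :: real
  defines "q \<equiv> a - real (card T) * b"
  shows "lower_ineq a b UNIV + (\<Sum>i\<in>-T. complement b (lower_ineq a b {i})) =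
    ((\<chi> i. if i \<in> T then - 1 else 0), q - real (card (-T)) * a, q)"
proof -
  have "real CARD('n) = real (card T) + real (card (-T))"
    using card_Un_disjoint[of T "-T"] by simp
  moreover have "(\<Sum>j\<in>-T. if i = j then 1 else 0) = (if i \<in> T then 0 else (1::real))" for i
    by simp
  ultimately show ?thesis
    unfolding complement_lower_ineq
    by (auto simp: prod_eq_iff lower_ineq_def q_def fst_sum snd_sum vec_eq_iff algebra_simps)
qed

text \<open>The multiplier of \<open>z \<le> 1\<close> is forced by the wish that the right-hand side have floor \<open>N\<close> and
  fractional part \<open>f\<close> when the first summand is scaled by \<open>r (1 - f)\<close>: it must be \<open>f (1 + N)\<close>.
  The value \<open>f = s / (1 + s)\<close> is the one for which the coefficient of \<open>z\<close> is the integer \<open>N\<close>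
  itself, so that the correction term of the rounding vanishes.\<close>

lemma mir_lower_ineq:
  fixes T :: "'n::finite set" and N :: int and a b :: real
  defines "q \<equiv> a - real (card T) * b"
  assumes "r > 0" "s \<ge> 0" "r * q = of_int N" "s = r * e"
  shows "mir ((r / (1 + s)) *\<^sub>R ((\<chi> i. if i \<in> T then - 1 else 0), q - e, q) +
      (s * (1 + of_int N) / (1 + s)) *\<^sub>R (0, 1, 1)) = r *\<^sub>R lower_ineq a b T"
proof -
  let ?f = "s / (1 + s)"
  have f: "0 \<le> ?f" "?f < 1" "1 - ?f = 1 / (1 + s)"
    using assms(3) by (auto simp: field_simps)
  have \<beta>: "r / (1 + s) * q + s * (1 + of_int N) / (1 + s) = of_int N + ?f"
  proof -
    have "r / (1 + s) * q + s * (1 + of_int N) / (1 + s) = (r * q + s * (1 + of_int N)) / (1 + s)"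
      by (simp add: add_divide_distrib)
    also have "\<dots> = of_int N + ?f"
      unfolding \<open>r * q = of_int N\<close> using \<open>s \<ge> 0\<close> by (simp add: field_simps)
    finally show ?thesis .
  qed
  have \<gamma>: "r / (1 + s) * (q - e) + s * (1 + of_int N) / (1 + s) = of_int N"
    using \<beta> \<open>s = r * e\<close> by (simp add: right_diff_distrib)
  have floor: "\<lfloor>of_int N + ?f\<rfloor> = N"
    using f by (intro floor_unique) auto
  then have frac: "frac (of_int N + ?f) = ?f"
    by (simp add: frac_def)
  let ?J = "(r / (1 + s)) *\<^sub>R ((\<chi> i. if i \<in> T then (- 1 :: real) else 0), q - e, q) +
      (s * (1 + of_int N) / (1 + s)) *\<^sub>R (0, 1, 1)"
  have "?J = ((\<chi> i. if i \<in> T then - r / (1 + s) else 0),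
      r / (1 + s) * (q - e) + s * (1 + of_int N) / (1 + s),
      r / (1 + s) * q + s * (1 + of_int N) / (1 + s))"
    by (simp add: vec_eq_iff)
  also have "\<dots> = ((\<chi> i. if i \<in> T then - r / (1 + s) else 0), of_int N, of_int N + ?f)"
    unfolding \<beta> \<gamma> ..
  finally have "mir ?J =
    ((1 / (1 - ?f)) *\<^sub>R (\<chi> i. if (if i \<in> T then - r / (1 + s) else 0) < 0
       then (if i \<in> T then - r / (1 + s) else 0) else 0),
     of_int N + max (0 - ?f) 0 / (1 - ?f), of_int N)"
    by (simp only: mir.simps floor frac floor_of_int frac_of_int vec_lambda_beta)
  also have "\<dots> = r *\<^sub>R lower_ineq a b T"
    unfolding lower_ineq_def q_def[symmetric] f(3) using assms(2-4) f(1)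
    by (auto simp: vec_eq_iff divide_less_0_iff max_def)
  finally show ?thesis .
qed

lemma lower_ineq_via_mir:
  fixes T :: "'n::finite set"
  assumes "a > 0"
  shows "\<exists>J\<in>nonneg_combs (other_facets a b). same_ineq (mir J) (lower_ineq a b T)"
proof -
  define q where "q = a - real (card T) * b"
  \<comment> \<open>The scaling makes \<open>r * q\<close> the sign of \<open>q\<close>: an integer that is at least \<open>-1\<close>.\<close>
  define r where "r = (if q = 0 then 1 else 1 / \<bar>q\<bar>)"
  define N :: int where "N = (if q = 0 then 0 else if q < 0 then - 1 else 1)"
  define e where "e = real (card (-T)) * a"
  define s where "s = r * e"
  define K where "K = lower_ineq a b UNIV + (\<Sum>i\<in>-T. complement b (lower_ineq a b {i}))"
  define J where "J = (r / (1 + s)) *\<^sub>R K + (s * (1 + of_int N) / (1 + s)) *\<^sub>R (0, 1, 1)"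
  have r: "r > 0" "r * q = of_int N" "- 1 \<le> N"
    by (auto simp: r_def N_def)
  have s: "s \<ge> 0"
    using assms r(1) by (simp add: s_def e_def)
  have "lower_ineq a b UNIV \<in> other_facets a b"
    using assms by (intro other_facetsI facet_describing_lower_ineq) (auto simp: support_lower_ineq)
  moreover have "complement b (lower_ineq a b {i}) \<in> other_facets a b" for i :: 'n
    using assms
    by (intro other_facetsI facet_describing_complement facet_describing_lower_ineq)
       (auto simp: support_complement support_lower_ineq)
  moreover have z: "(0, 1, 1) \<in> (other_facets a b :: 'n ineq set)"
    using assms by (intro other_facetsI facet_describing_z_le_1) (auto simp: support_def)
  ultimately have "K \<in> nonneg_combs (other_facets a b)"
    unfolding K_def by (intro nonneg_combs_add nonneg_combs_sum nonneg_combs_base) auto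
  moreover have "r / (1 + s) \<ge> 0" "s * (1 + of_int N) / (1 + s) \<ge> 0"
    using r s by auto
  ultimately have "J \<in> nonneg_combs (other_facets a b)"
    unfolding J_def using nonneg_combs_base[OF z]
    by (intro nonneg_combs_add nonneg_combs_scaleR)
  moreover have "mir J = r *\<^sub>R lower_ineq a b T"
    using mir_lower_ineq[OF r(1) s r(2)[unfolded q_def] s_def]
    unfolding J_def K_def lower_ineq_UNIV_plus_upper_bounds e_def .
  ultimately show ?thesis
    using r(1) by (auto simp: same_ineq_def)
qed

theorem theorem14:
  fixes a b :: real and I :: "'n::finite ineq"
  assumes "CARD('n) \<ge> 3"
    and "a > 0"
    and "I \<in> type_A a b \<union> type_B a b"
  shows "facet_describing (D a b) I \<and> obtained_via_mir b (other_facets a b) I"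
proof -
  have A: "facet_describing (D a b) I' \<and>
      (\<exists>J\<in>nonneg_combs (other_facets a b). same_ineq (mir J) I')"
    if I': "I' \<in> type_A a b" for I' :: "'n ineq"
  proof -
    from I' obtain T :: "'n set" where "I' = lower_ineq a b T" "2 \<le> card T"
      unfolding type_A_eq by blast
    moreover from this have "T \<noteq> {}" by auto
    ultimately show ?thesis
      using facet_describing_lower_ineq lower_ineq_via_mir \<open>a > 0\<close> by blast
  qed
  from assms(3) show ?thesis
  proof
    assume "I \<in> type_A a b"
    then show ?thesis
      using A by (auto simp: obtained_via_mir_def)
  next
    assume "I \<in> type_B a b"
    then obtain I' where I': "I' \<in> type_A a b" "I = complement b I'"
      unfolding type_B_eq by blast
    from A[OF I'(1)] obtain J where facet: "facet_describing (D a b) I'"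
      and J: "J \<in> nonneg_combs (other_facets a b)" "same_ineq (mir J) I'" by blast
    have "same_ineq (complement b (mir J)) I"
      unfolding I'(2) by (rule same_ineq_complement[OF J(2)])
    moreover have "J \<in> nonneg_combs (complement b ` other_facets a b)"
      using J(1) unfolding complement_other_facets .
    ultimately show ?thesis
      using facet_describing_complement[OF facet] unfolding obtained_via_mir_def I'(2) by blast
  qed
qed

end
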